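(* The one-sided Hopf algebra of simplices $\Delta\mathit{Sym}$ is cofree as a coalgebra.
   Context: $\mathbb{K}$ is a field of characteristic zero. For $n\ge0$ write $[n]=\{1,\dots,n\}$. $\Delta\mathit{Sym}=\bigoplus_{n\ge0}\Delta\mathit{Sym}_n$ is the graded $\mathbb{K}$-vector space where $\Delta\mathit{Sym}_n$ has basis $\{F^{[n]}_{S}\mid S\subseteq[n]\}$ (subsets $S$ correspond to faces of the $(n-1)$-dimensional simplex). Its coproduct is $$\Delta(F^{[n]}_S)=\sum_{p+q=n}F^{[p]}_{S'}\otimes F^{[q]}_{S''},\qquad S'=S\cap[p],\quad S''=\{j\in[q]\mid j+p\in S\},$$ and its counit is projection onto $\Delta\mathit{Sym}_0=\mathbb{K}F^{\emptyset}_\emptyset$. Its product is as follows: $F^{[p]}_S\cdot F^{[q]}_T=\sum_A F^{[p+q]}_{A\cup\psi_A(T)}$, the sum over all $p$-element subsets $A\subseteq[p+q]$ (shuffles), where $\psi_A\colon[q]\to[p+q]\setminus A$ is the order-preserving bijection. The cofree coalgebra on a vector space $V$ is $\mathsf{C}(V)=\bigoplus_{n\ge0}V^{\otimes n}$ with the deconcatenation coproduct $\Delta(v_1\backslash\dotsb\backslash v_n)=\sum_{i=0}^n (v_1\backslash\dotsb\backslash v_i)\otimes(v_{i+1}\backslash\dotsb\backslash v_n)$ (where $\backslash$ denotes the tensor product in $V^{\otimes n}$) and counit the projection onto $V^{\otimes 0}=\mathbb{K}$. A coalgebra is cofree if it is isomorphic, as a coalgebra, to $\mathsf{C}(V)$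 for some vector space $V$ (necessarily its space of primitive elements). *)

theory Defs
  imports
    "HOL-Library.Poly_Mapping"
    "HOL-Algebra.QuotRing"
    "Jordan_Normal_Form.VS_Connect"
begin

text \<open>
  Vector spaces over \<open>'k\<close> are the carrier-based ones of \<^locale>\<open>vectorspace\<close>, with the type \<open>'k\<close>
  as scalars through \<^term>\<open>class_ring\<close>. The fields \<open>mult\<close> and \<open>one\<close> of a module record play no role
  in its vector space structure.
\<close>

definition free_vs :: "'x set \<Rightarrow> ('k::field, 'x \<Rightarrow>\<^sub>0 'k) module" where
  "free_vs X = \<lparr>carrier = {f. Poly_Mapping.keys f \<subseteq> X}, mult = undefined, one = undefined,
     zero = 0, add = (+), smult = (\<lambda>c. Poly_Mapping.map ((*) c))\<rparr>"

definition lin_ext :: "('x \<Rightarrow> 'y \<Rightarrow>\<^sub>0 'k) \<Rightarrow> ('x \<Rightarrow>\<^sub>0 'k) \<Rightarrow> ('y \<Rightarrow>\<^sub>0 'k::field)" where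
  "lin_ext g f =
     (\<Sum>x\<in>Poly_Mapping.keys f. Poly_Mapping.map ((*) (Poly_Mapping.lookup f x)) (g x))"

text \<open>
  The value on a coset \<open>A\<close> of the map into \<open>M / N\<close> induced by \<open>g\<close>. As in \<^const>\<open>rcoset_mult\<close>, the
  union ranges over equal cosets whenever \<open>g\<close> respects the relations; this is the case in all
  uses below.
\<close>

definition induced_map ::
    "('k, 'v, 'm) module_scheme \<Rightarrow> 'v set \<Rightarrow> ('u \<Rightarrow> 'v) \<Rightarrow> 'u set \<Rightarrow> 'v set" where
  "induced_map M N g A = (\<Union>a\<in>A. N +>\<^bsub>M\<^esub> g a)"

definition quotient_vs :: "('k, 'v, 'm) module_scheme \<Rightarrow> 'v set \<Rightarrow> ('k, 'v set) module" where
  "quotient_vs M N = \<lparr>carrier = a_rcosets\<^bsub>M\<^esub> N, mult = undefined, one = undefined,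
     zero = N, add = (<+>\<^bsub>M\<^esub>), smult = (\<lambda>c. induced_map M N (\<lambda>a. c \<odot>\<^bsub>M\<^esub> a))\<rparr>"

definition bilinear_relations ::
    "('k, 'v, 'm) module_scheme \<Rightarrow> ('k, 'w, 'n) module_scheme \<Rightarrow> ('v \<times> 'w \<Rightarrow>\<^sub>0 'k::field) set" where
  "bilinear_relations V W =
     {Poly_Mapping.single (x \<oplus>\<^bsub>V\<^esub> x', y) 1 - Poly_Mapping.single (x, y) 1
        - Poly_Mapping.single (x', y) 1
      | x x' y. x \<in> carrier V \<and> x' \<in> carrier V \<and> y \<in> carrier W}
   \<union> {Poly_Mapping.single (x, y \<oplus>\<^bsub>W\<^esub> y') 1 - Poly_Mapping.single (x, y) 1
        - Poly_Mapping.single (x, y') 1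
      | x y y'. x \<in> carrier V \<and> y \<in> carrier W \<and> y' \<in> carrier W}
   \<union> {Poly_Mapping.single (c \<odot>\<^bsub>V\<^esub> x, y) 1 - Poly_Mapping.single (x, y) c
      | c x y. x \<in> carrier V \<and> y \<in> carrier W}
   \<union> {Poly_Mapping.single (x, c \<odot>\<^bsub>W\<^esub> y) 1 - Poly_Mapping.single (x, y) c
      | c x y. x \<in> carrier V \<and> y \<in> carrier W}"

definition bilinear_null ::
    "('k, 'v, 'm) module_scheme \<Rightarrow> ('k, 'w, 'n) module_scheme \<Rightarrow> ('v \<times> 'w \<Rightarrow>\<^sub>0 'k::field) set" where
  "bilinear_null V W =
     LinearCombinations.module.span class_ring (free_vs (carrier V \<times> carrier W))
       (bilinear_relations V W)"

definition tensor_product ::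
    "('k, 'v, 'm) module_scheme \<Rightarrow> ('k, 'w, 'n) module_scheme
     \<Rightarrow> ('k::field, ('v \<times> 'w \<Rightarrow>\<^sub>0 'k) set) module" where
  "tensor_product V W =
     quotient_vs (free_vs (carrier V \<times> carrier W)) (bilinear_null V W)"

text \<open>The class in \<open>V \<otimes> W\<close> of a formal linear combination of pairs, \<open>(x, y)\<close> standing for \<open>x \<otimes> y\<close>.\<close>

definition tensor_class ::
    "('k, 'v, 'm) module_scheme \<Rightarrow> ('k, 'w, 'n) module_scheme
     \<Rightarrow> ('v \<times> 'w \<Rightarrow>\<^sub>0 'k::field) \<Rightarrow> ('v \<times> 'w \<Rightarrow>\<^sub>0 'k) set" where
  "tensor_class V W f = bilinear_null V W +>\<^bsub>free_vs (carrier V \<times> carrier W)\<^esub> f"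

text \<open>Only the target \<open>V' \<otimes> W'\<close> of \<open>\<phi> \<otimes> \<psi>\<close> is an argument, as the classes of the source are sets of
  representatives.\<close>

definition tensor_map ::
    "('k, 'v2, 'm) module_scheme \<Rightarrow> ('k, 'w2, 'n) module_scheme \<Rightarrow> ('v \<Rightarrow> 'v2) \<Rightarrow> ('w \<Rightarrow> 'w2)
     \<Rightarrow> ('v \<times> 'w \<Rightarrow>\<^sub>0 'k::field) set \<Rightarrow> ('v2 \<times> 'w2 \<Rightarrow>\<^sub>0 'k) set" where
  "tensor_map V' W' \<phi> \<psi> =
     induced_map (free_vs (carrier V' \<times> carrier W')) (bilinear_null V' W')
       (lin_ext (\<lambda>(x, y). Poly_Mapping.single (\<phi> x, \<psi> y) 1))"

record (overloaded) ('k, 'v) coalgebra = "('k, 'v) module" +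
  comult :: "'v \<Rightarrow> ('v \<times> 'v \<Rightarrow>\<^sub>0 'k) set"
  counit :: "'v \<Rightarrow> 'k"

definition coalgebra_iso ::
    "('k::field, 'v, 'm) coalgebra_scheme \<Rightarrow> ('k, 'w, 'n) coalgebra_scheme \<Rightarrow> ('v \<Rightarrow> 'w) \<Rightarrow> bool" where
  "coalgebra_iso C D \<phi> \<longleftrightarrow>
     linear_map class_ring C D \<phi> \<and>
     bij_betw \<phi> (carrier C) (carrier D) \<and>
     comult C \<in> carrier C \<rightarrow> carrier (tensor_product C C) \<and>
     comult D \<in> carrier D \<rightarrow> carrier (tensor_product D D) \<and>
     (\<forall>x\<in>carrier C. comult D (\<phi> x) = tensor_map D D \<phi> \<phi> (comult C x)) \<and>
     (\<forall>x\<in>carrier C. counit D (\<phi> x) = counit C x)"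

definition multilinear_relations ::
    "('k, 'v, 'm) module_scheme \<Rightarrow> ('v list \<Rightarrow>\<^sub>0 'k::field) set" where
  "multilinear_relations V =
     {Poly_Mapping.single (us @ (x \<oplus>\<^bsub>V\<^esub> y) # ws) 1 - Poly_Mapping.single (us @ x # ws) 1
        - Poly_Mapping.single (us @ y # ws) 1
      | us x y ws. us \<in> lists (carrier V) \<and> x \<in> carrier V \<and> y \<in> carrier V
          \<and> ws \<in> lists (carrier V)}
   \<union> {Poly_Mapping.single (us @ (c \<odot>\<^bsub>V\<^esub> x) # ws) 1 - Poly_Mapping.single (us @ x # ws) c
      | us c x ws. us \<in> lists (carrier V) \<and> x \<in> carrier V \<and> ws \<in> lists (carrier V)}"

definition multilinear_null :: "('k, 'v, 'm) module_scheme \<Rightarrow> ('v list \<Rightarrow>\<^sub>0 'k::field) set" where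
  "multilinear_null V =
     LinearCombinations.module.span class_ring (free_vs (lists (carrier V)))
       (multilinear_relations V)"

text \<open>
  The direct sum of all tensor powers of \<open>V\<close>: each relation involves words of a single length \<open>n\<close>,
  so the quotient of the space on all words is the direct sum over \<open>n\<close> of the quotients of the
  spaces on words of length \<open>n\<close>, and these are the tensor powers. The empty word spans the power
  of exponent 0.
\<close>

definition tensor_powers ::
    "('k, 'v, 'm) module_scheme \<Rightarrow> ('k::field, ('v list \<Rightarrow>\<^sub>0 'k) set) module" where
  "tensor_powers V = quotient_vs (free_vs (lists (carrier V))) (multilinear_null V)"

definition pure_tensor :: "('k, 'v, 'm) module_scheme \<Rightarrow> 'v list \<Rightarrow> ('v list \<Rightarrow>\<^sub>0 'k::field) set" where
  "pure_tensor V vs = multilinear_null V +>\<^bsub>free_vs (lists (carrier V))\<^esub> Poly_Mapping.single vs 1"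

definition deconcatenation ::
    "('k, 'v, 'm) module_scheme \<Rightarrow> ('v list \<Rightarrow>\<^sub>0 'k::field) set
     \<Rightarrow> (('v list \<Rightarrow>\<^sub>0 'k) set \<times> ('v list \<Rightarrow>\<^sub>0 'k) set \<Rightarrow>\<^sub>0 'k) set" where
  "deconcatenation V =
     induced_map (free_vs (carrier (tensor_powers V) \<times> carrier (tensor_powers V)))
       (bilinear_null (tensor_powers V) (tensor_powers V))
       (lin_ext (\<lambda>vs. \<Sum>i\<le>length vs.
          Poly_Mapping.single (pure_tensor V (take i vs), pure_tensor V (drop i vs)) 1))"

text \<open>
  The coefficient of the empty word is the same in all representatives of a class, as no relation
  involves the empty word.
\<close>

definition cofree_coalgebra ::
    "('k, 'v, 'm) module_scheme \<Rightarrow> ('k::field, ('v list \<Rightarrow>\<^sub>0 'k) set) coalgebra" where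
  "cofree_coalgebra V = module.extend (tensor_powers V)
     (coalgebra.fields (deconcatenation V) (\<lambda>A. THE c. \<forall>f\<in>A. Poly_Mapping.lookup f [] = c))"

text \<open>
  Taking \<open>V\<close> on the element type of \<open>C\<close> is no restriction: an isomorphism of \<open>C\<close> with the cofree
  coalgebra on \<open>V\<close> embeds \<open>V\<close>, as its first tensor power, into \<open>C\<close>.
\<close>

definition cofree :: "('k::field, 'v, 'm) coalgebra_scheme \<Rightarrow> bool" where
  "cofree C \<longleftrightarrow> (\<exists>(V :: ('k, 'v) module) \<phi>.
     vectorspace class_ring V \<and> coalgebra_iso C (cofree_coalgebra V) \<phi>)"

text \<open>The pair \<open>(n, S)\<close> with \<open>S \<subseteq> {1..n}\<close> is the index of the basis element \<open>face_elt n S\<close> of degree \<open>n\<close>.\<close>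

definition faces :: "(nat \<times> nat set) set" where
  "faces = {(n, S). S \<subseteq> {1..n}}"

definition face_elt :: "nat \<Rightarrow> nat set \<Rightarrow> (nat \<times> nat set) \<Rightarrow>\<^sub>0 'k::field" where
  "face_elt n S = Poly_Mapping.single (n, S) 1"

definition DeltaSym_comult ::
    "((nat \<times> nat set) \<Rightarrow>\<^sub>0 'k::field)
     \<Rightarrow> (((nat \<times> nat set) \<Rightarrow>\<^sub>0 'k) \<times> ((nat \<times> nat set) \<Rightarrow>\<^sub>0 'k) \<Rightarrow>\<^sub>0 'k) set" where
  "DeltaSym_comult f = tensor_class (free_vs faces) (free_vs faces)
     (lin_ext (\<lambda>(n, S). \<Sum>p\<le>n.
        Poly_Mapping.single
          (face_elt p (S \<inter> {1..p}), face_elt (n - p) {j \<in> {1..n - p}. j + p \<in> S}) 1) f)"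

text \<open>The order-preserving bijection from \<open>{1..q}\<close> onto the complement of \<open>A\<close> in \<open>{1..p + q}\<close>, where
  \<open>n = p + q\<close> and \<open>A\<close> has \<open>p\<close> elements.\<close>

definition shuffle_map :: "nat \<Rightarrow> nat set \<Rightarrow> nat \<Rightarrow> nat" where
  "shuffle_map n A j = sorted_list_of_set ({1..n} - A) ! (j - 1)"

definition DeltaSym_mult ::
    "((nat \<times> nat set) \<Rightarrow>\<^sub>0 'k::field) \<Rightarrow> ((nat \<times> nat set) \<Rightarrow>\<^sub>0 'k) \<Rightarrow> ((nat \<times> nat set) \<Rightarrow>\<^sub>0 'k)" where
  "DeltaSym_mult f g =
     lin_ext (\<lambda>(p, S). lin_ext (\<lambda>(q, T). \<Sum>A | A \<subseteq> {1..p + q} \<and> card A = p.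
       face_elt (p + q) (A \<union> shuffle_map (p + q) A ` T)) g) f"

text \<open>The fields \<open>mult\<close> and \<open>one\<close> hold the product and its one-sided (left) unit.\<close>

definition DeltaSym :: "('k::field, (nat \<times> nat set) \<Rightarrow>\<^sub>0 'k) coalgebra" where
  "DeltaSym = module.extend ((free_vs faces)\<lparr>mult := DeltaSym_mult, one := face_elt 0 {}\<rparr>)
     (coalgebra.fields DeltaSym_comult (\<lambda>f. Poly_Mapping.lookup f (0, {})))"

end

theory Submission
  imports Defs
begin

text \<open>
  A face \<open>S \<subseteq> [n]\<close> is the same as its indicator word, a word of length \<open>n\<close> in two letters, and each
  pair \<open>(p, q)\<close> in the coproduct of \<open>F\<^bsub>S\<^esub>\<close> cuts this word after its first \<open>p\<close> letters
  (\<open>take_face_word\<close>, \<open>drop_face_word\<close>). The coproduct is thus deconcatenation of words. If \<open>V\<close> is the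
  plane with the two letters as a basis, then the words of length \<open>n\<close> form a basis of the \<open>n\<close>-th
  tensor power of \<open>V\<close>, on which the coproduct of the cofree coalgebra is deconcatenation too. Sending a
  face to the pure tensor of the letters of its word is therefore an isomorphism of coalgebras; the
  counits agree since the empty word is the word of the only face of degree 0.

  Tensor products and tensor powers are quotients of free vector spaces by the span of the bilinear
  or multilinear relations, so the substance of the proof lies in two facts about these quotients.
  Deconcatenation and \<open>\<phi> \<otimes> \<phi>\<close> are well defined and can be computed on representatives
  (\<open>deconcatenation_coset\<close>, \<open>tensor_map_tensor_class\<close>); on suitable representatives both sides of the
  comultiplicativity condition are literally equal. And the words in a basis of \<open>V\<close> form a basis of
  the tensor powers (\<open>word_tensor_bij\<close>): they span since vectors can be expanded letter by letter, and
  they are independent since this expansion is multilinear, hence vanishes on all relations, and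
  fixes the words themselves.
\<close>

section \<open>Linear maps on free vector spaces\<close>

abbreviation scal :: "'k::field \<Rightarrow> ('x \<Rightarrow>\<^sub>0 'k) \<Rightarrow> ('x \<Rightarrow>\<^sub>0 'k)" where
  "scal c \<equiv> Poly_Mapping.map ((*) c)"

lemma lookup_scal [simp]: "Poly_Mapping.lookup (scal c f) x = c * Poly_Mapping.lookup f x"
  by (cases "Poly_Mapping.lookup f x = 0") (simp_all add: Poly_Mapping.map.rep_eq when_def)

lemma scal_single [simp]: "scal c (Poly_Mapping.single x d) = Poly_Mapping.single x (c * d)"
  by (rule poly_mapping_eqI) (simp add: lookup_single when_def)

lemma scal_algebra:
  shows scal_add: "scal c (f + g) = scal c f + scal c g"
    and scal_add_scalars: "scal (c + d) f = scal c f + scal d f"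
    and scal_scal: "scal (c * d) f = scal c (scal d f)"
    and scal_one: "scal 1 f = f"
    and scal_zero: "scal c 0 = 0"
    and scal_minus_one: "scal (-1) f = - f"
    and scal_diff: "scal c (f - g) = scal c f - scal c g"
    and scal_zero_scalar: "scal 0 f = 0"
  by (rule poly_mapping_eqI; simp add: lookup_add lookup_minus algebra_simps)+

lemma keys_scal: "Poly_Mapping.keys (scal c f) \<subseteq> Poly_Mapping.keys f"
  by (auto simp: in_keys_iff)

lemma lin_ext_superset:
  assumes "finite A" "Poly_Mapping.keys f \<subseteq> A"
  shows "lin_ext g f = (\<Sum>x\<in>A. scal (Poly_Mapping.lookup f x) (g x))"
  unfolding lin_ext_def using assms
  by (intro sum.mono_neutral_left) (auto simp: in_keys_iff scal_algebra)

lemma lin_ext_add: "lin_ext g (f + h) = lin_ext g f + lin_ext g h"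
proof -
  let ?A = "Poly_Mapping.keys f \<union> Poly_Mapping.keys h"
  have "lin_ext g q = (\<Sum>x\<in>?A. scal (Poly_Mapping.lookup q x) (g x))"
    if "Poly_Mapping.keys q \<subseteq> ?A" for q
    using that by (intro lin_ext_superset) auto
  then show ?thesis
    using keys_add[of f h] by (simp add: lookup_add scal_algebra sum.distrib)
qed

lemma scal_sum: "scal c (sum g A) = (\<Sum>x\<in>A. scal c (g x))"
  by (induction A rule: infinite_finite_induct) (simp_all add: scal_algebra)

lemma lin_ext_scal: "lin_ext g (scal c f) = scal c (lin_ext g f)"
proof -
  have "lin_ext g (scal c f)
      = (\<Sum>x\<in>Poly_Mapping.keys f. scal (Poly_Mapping.lookup (scal c f) x) (g x))"
    by (rule lin_ext_superset) (simp_all add: keys_scal)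
  then show ?thesis
    by (simp add: lin_ext_def scal_sum scal_algebra)
qed

lemma lin_ext_0 [simp]: "lin_ext g 0 = 0"
  by (simp add: lin_ext_def)

lemma lin_ext_diff: "lin_ext g (f - h) = lin_ext g f - lin_ext g h"
proof -
  have "lin_ext g (f + scal (-1) h) = lin_ext g f + scal (-1) (lin_ext g h)"
    by (simp only: lin_ext_add lin_ext_scal)
  then show ?thesis
    by (simp add: scal_minus_one)
qed

lemma lin_ext_single [simp]: "lin_ext g (Poly_Mapping.single x c) = scal c (g x)"
  by (simp add: lin_ext_superset[of "{x}"])

lemma lin_ext_sum: "lin_ext g (sum h A) = (\<Sum>x\<in>A. lin_ext g (h x))"
  by (induction A rule: infinite_finite_induct) (simp_all add: lin_ext_add)

lemma lin_ext_lin_ext: "lin_ext g (lin_ext h f) = lin_ext (\<lambda>x. lin_ext g (h x)) f"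
  by (simp add: lin_ext_def[of h] lin_ext_def[of "\<lambda>x. lin_ext g (h x)"] lin_ext_sum lin_ext_scal)

lemma lin_ext_swap:
  "lin_ext (\<lambda>w. lin_ext (\<lambda>x. g x w) f) h = lin_ext (\<lambda>x. lin_ext (\<lambda>w. g x w) h) f"
proof -
  have "lin_ext (\<lambda>w. lin_ext (\<lambda>x. g x w) f) h = (\<Sum>w\<in>Poly_Mapping.keys h. \<Sum>x\<in>Poly_Mapping.keys f.
      scal (Poly_Mapping.lookup h w * Poly_Mapping.lookup f x) (g x w))"
    by (simp add: lin_ext_def scal_sum scal_scal)
  also have "\<dots> = (\<Sum>x\<in>Poly_Mapping.keys f. \<Sum>w\<in>Poly_Mapping.keys h.
      scal (Poly_Mapping.lookup f x * Poly_Mapping.lookup h w) (g x w))"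
    by (subst sum.swap) (simp add: mult.commute)
  also have "\<dots> = lin_ext (\<lambda>x. lin_ext (\<lambda>w. g x w) h) f"
    by (simp add: lin_ext_def scal_sum scal_scal)
  finally show ?thesis .
qed

lemma lin_ext_plus: "lin_ext (\<lambda>x. g x + h x) f = lin_ext g f + lin_ext h f"
  by (simp add: lin_ext_def scal_algebra sum.distrib)

lemma lin_ext_minus: "lin_ext (\<lambda>x. g x - h x) f = lin_ext g f - lin_ext h f"
  by (simp add: lin_ext_def scal_algebra sum_subtractf)

lemma lin_ext_scaled: "lin_ext (\<lambda>x. scal c (g x)) f = scal c (lin_ext g f)"
  by (simp add: lin_ext_def scal_sum mult.commute[of c] flip: scal_scal)

lemma lin_ext_cong:
  "(\<And>x. x \<in> Poly_Mapping.keys f \<Longrightarrow> g x = h x) \<Longrightarrow> lin_ext g f = lin_ext h f"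
  unfolding lin_ext_def by (rule sum.cong) simp_all

lemma lin_ext_basis [simp]: "lin_ext (\<lambda>x. Poly_Mapping.single x 1) f = f"
  by (rule poly_mapping_eqI)
    (auto simp: lin_ext_def lookup_sum lookup_single when_def in_keys_iff sum.delta
       if_distrib[of "(*) _"] cong: if_cong)

lemma lookup_lin_ext_single:
  assumes "inj_on w B" "Poly_Mapping.keys f \<subseteq> B" "b \<in> B"
  shows "Poly_Mapping.lookup (lin_ext (\<lambda>b. Poly_Mapping.single (w b) 1) f) (w b)
    = Poly_Mapping.lookup f b"
proof -
  have "Poly_Mapping.lookup (lin_ext (\<lambda>b. Poly_Mapping.single (w b) 1) f) (w b)
      = (\<Sum>x\<in>Poly_Mapping.keys f. if x = b then Poly_Mapping.lookup f x else 0)"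
    unfolding lin_ext_def lookup_sum
    by (rule sum.cong) (use assms in \<open>auto simp: lookup_single when_def dest: inj_onD\<close>)
  then show ?thesis
    by (simp add: in_keys_iff)
qed

section \<open>Subspaces and quotients of free vector spaces\<close>

text \<open>Subspaces, without an ambient space: whether a set of finitely supported functions is
  closed under linear combinations does not depend on the free vector space that contains it, so
  that preimages under \<^const>\<open>lin_ext\<close> need no restriction to a carrier.\<close>

definition lin_closed :: "('x \<Rightarrow>\<^sub>0 'k::field) set \<Rightarrow> bool" where
  "lin_closed N \<longleftrightarrow> 0 \<in> N \<and> (\<forall>f\<in>N. \<forall>g\<in>N. f + g \<in> N) \<and> (\<forall>c. \<forall>f\<in>N. scal c f \<in> N)"

lemma lin_closedD:
  assumes "lin_closed N"
  shows lin_closed_zero: "0 \<in> N"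
    and lin_closed_add: "f \<in> N \<Longrightarrow> g \<in> N \<Longrightarrow> f + g \<in> N"
    and lin_closed_scal: "f \<in> N \<Longrightarrow> scal c f \<in> N"
    and lin_closed_diff: "f \<in> N \<Longrightarrow> g \<in> N \<Longrightarrow> f - g \<in> N"
proof -
  show *: "0 \<in> N" "f \<in> N \<Longrightarrow> g \<in> N \<Longrightarrow> f + g \<in> N" "f \<in> N \<Longrightarrow> scal c f \<in> N" for f g c
    using assms by (auto simp: lin_closed_def)
  show "f \<in> N \<Longrightarrow> g \<in> N \<Longrightarrow> f - g \<in> N"
    using *(2)[of f "- g"] *(3)[of g "-1"] by (simp add: scal_minus_one)
qed

lemma lin_closed_sum:
  assumes "lin_closed N" "\<And>x. x \<in> A \<Longrightarrow> g x \<in> N"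
  shows "sum g A \<in> N"
  using assms(2)
  by (induction A rule: infinite_finite_induct) (simp_all add: lin_closedD[OF assms(1)])

lemma lin_closed_lin_ext:
  assumes "lin_closed N" "\<And>x. x \<in> Poly_Mapping.keys f \<Longrightarrow> g x \<in> N"
  shows "lin_ext g f \<in> N"
  unfolding lin_ext_def using assms by (intro lin_closed_sum) (simp_all add: lin_closedD)

lemma lin_closed_vimage: "lin_closed N \<Longrightarrow> lin_closed (lin_ext g -` N)"
  by (simp add: lin_closed_def lin_ext_add lin_ext_scal)

lemma free_vs_simps [simp]:
  "carrier (free_vs X) = {f. Poly_Mapping.keys f \<subseteq> X}"
  "zero (free_vs X) = 0" "add (free_vs X) = (+)" "smult (free_vs X) = scal"
  by (simp_all add: free_vs_def)

lemma lin_closed_carrier: "lin_closed {f. Poly_Mapping.keys f \<subseteq> X}"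
  by (simp add: lin_closed_def order_trans[OF keys_add] order_trans[OF keys_scal])

lemma free_vs_induct:
  assumes "lin_closed P" "\<And>x. x \<in> X \<Longrightarrow> Poly_Mapping.single x 1 \<in> P" "Poly_Mapping.keys f \<subseteq> X"
  shows "f \<in> P"
  using lin_closed_lin_ext[OF assms(1), of f "\<lambda>x. Poly_Mapping.single x 1"] assms(2,3) by auto

lemma keys_lin_ext:
  assumes "\<And>x. x \<in> Poly_Mapping.keys f \<Longrightarrow> Poly_Mapping.keys (g x) \<subseteq> Y"
  shows "Poly_Mapping.keys (lin_ext g f) \<subseteq> Y"
  using lin_closed_lin_ext[OF lin_closed_carrier, of f g Y] assms by simp

lemma keys_sum_pairs:
  fixes c :: "'k::field"
  assumes "\<And>i. i \<in> I \<Longrightarrow> a i \<in> A" "\<And>i. i \<in> I \<Longrightarrow> b i \<in> B"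
  shows "Poly_Mapping.keys (\<Sum>i\<in>I. Poly_Mapping.single (a i, b i) c) \<subseteq> A \<times> B"
  using lin_closed_sum[OF lin_closed_carrier[of "A \<times> B"], of I "\<lambda>i. Poly_Mapping.single (a i, b i) c"]
    assms by simp

text \<open>Free vector spaces are functorial: the linear extension of the inverse bijection is
  the inverse.\<close>

lemma bij_betw_free_vs:
  assumes "bij_betw w B C"
  shows "bij_betw (lin_ext (\<lambda>b. Poly_Mapping.single (w b) (1::'k::field)))
    (carrier (free_vs B)) (carrier (free_vs C))"
proof (rule bij_betw_byWitness)
  let ?r = "\<lambda>w f. lin_ext (\<lambda>b. Poly_Mapping.single (w b) (1::'k)) f"
  let ?v = "inv_into B w"
  have *: "?r v (?r u f) = f" if "Poly_Mapping.keys f \<subseteq> A" "\<And>a. a \<in> A \<Longrightarrow> v (u a) = a"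
    for u :: "'c \<Rightarrow> 'd" and v A f
  proof -
    have "?r v (?r u f) = lin_ext (\<lambda>b. Poly_Mapping.single (v (u b)) 1) f"
      by (simp add: lin_ext_lin_ext scal_algebra)
    also have "\<dots> = lin_ext (\<lambda>b. Poly_Mapping.single b 1) f"
      by (rule lin_ext_cong) (use that in auto)
    finally show ?thesis by simp
  qed
  show "\<forall>f\<in>carrier (free_vs B). ?r ?v (?r w f) = f"
    using *[of _ B ?v w] bij_betw_inv_into_left[OF assms] by simp
  show "\<forall>f\<in>carrier (free_vs C). ?r w (?r ?v f) = f"
    using *[of _ C w ?v] bij_betw_inv_into_right[OF assms] by simp
  show "?r w ` carrier (free_vs B) \<subseteq> carrier (free_vs C)"
    using bij_betwE[OF assms] by (auto intro!: keys_lin_ext)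
  show "?r ?v ` carrier (free_vs C) \<subseteq> carrier (free_vs B)"
    using bij_betwE[OF bij_betw_inv_into[OF assms]] by (auto intro!: keys_lin_ext)
qed

lemma vectorspace_free_vs:
  fixes X :: "'x set"
  shows "vectorspace class_ring (free_vs X :: ('k::field, 'x \<Rightarrow>\<^sub>0 'k) module)"
proof (rule vs_criteria, rule class_field, goal_cases)
  case 3
  show ?case
  proof
    fix v :: "'x \<Rightarrow>\<^sub>0 'k" assume "v \<in> carrier (free_vs X)"
    then show "\<exists>w\<in>carrier (free_vs X). v \<oplus>\<^bsub>free_vs X\<^esub> w = \<zero>\<^bsub>free_vs X\<^esub>"
      by (intro bexI[of _ "- v"]) (simp_all add: in_keys_iff subset_iff)
  qed
qed (use lin_closedD(1-3)[OF lin_closed_carrier[of X, where 'b='k]] in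
      \<open>simp_all add: scal_algebra ac_simps\<close>)

lemma vectorspace_cong:
  fixes M :: "('k::field, 'v, 'm) module_scheme" and M' :: "('k, 'v, 'n) module_scheme"
  assumes "vectorspace class_ring M" "carrier M' = carrier M" "zero M' = zero M" "add M' = add M"
    "smult M' = smult M"
  shows "vectorspace class_ring M'"
proof -
  interpret vectorspace class_ring M by fact
  show ?thesis
  proof (rule vs_criteria, rule class_field)
    show "\<forall>v\<in>carrier M'. \<exists>w\<in>carrier M'. v \<oplus>\<^bsub>M'\<^esub> w = \<zero>\<^bsub>M'\<^esub>"
      unfolding assms using M.r_neg M.a_inv_closed by blast
  qed (simp_all add: assms M.a_ac smult_r_distr smult_assoc1[simplified] smult_l_distr[simplified]
      smult_one[simplified])
qed

lemma vectorspace_closed: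
  assumes "vectorspace class_ring V"
  shows "x \<in> carrier V \<Longrightarrow> y \<in> carrier V \<Longrightarrow> x \<oplus>\<^bsub>V\<^esub> y \<in> carrier V"
    and "x \<in> carrier V \<Longrightarrow> c \<odot>\<^bsub>V\<^esub> x \<in> carrier V"
proof -
  interpret vectorspace class_ring V by fact
  show "x \<in> carrier V \<Longrightarrow> y \<in> carrier V \<Longrightarrow> x \<oplus>\<^bsub>V\<^esub> y \<in> carrier V" by simp
  show "x \<in> carrier V \<Longrightarrow> c \<odot>\<^bsub>V\<^esub> x \<in> carrier V" by (rule smult_closed) simp_all
qed

abbreviation lin_hom where
  "lin_hom \<equiv> LinearCombinations.module_hom class_ring"

lemma span_free_vs:
  fixes R :: "('x \<Rightarrow>\<^sub>0 'k::field) set"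
  assumes "R \<subseteq> carrier (free_vs X)"
  shows lin_closed_span: "lin_closed (LinearCombinations.module.span class_ring (free_vs X) R)"
    and span_superset: "R \<subseteq> LinearCombinations.module.span class_ring (free_vs X) R"
    and span_minimal:
      "lin_closed P \<Longrightarrow> R \<subseteq> P \<Longrightarrow> LinearCombinations.module.span class_ring (free_vs X) R \<subseteq> P"
proof -
  interpret vectorspace class_ring "free_vs X" by (rule vectorspace_free_vs)
  have sub: "submodule class_ring (span R) (free_vs X)"
    by (rule span_is_submodule[OF assms])
  show "lin_closed (span R)"
    using submodule.m_closed[OF sub] submodule.zero_closed[OF sub] submodule.smult_closed[OF sub]
    by (simp add: lin_closed_def)
  show "R \<subseteq> span R" by (rule in_own_span[OF assms])
  assume P: "lin_closed P" "R \<subseteq> P"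
  have "submodule class_ring (P \<inter> carrier (free_vs X)) (free_vs X)"
    using lin_closedD[OF P(1)] lin_closedD(1-3)[OF lin_closed_carrier[of X, where 'b='k]]
    by (intro submodule.intro module_axioms) simp_all
  then have "span R \<subseteq> P \<inter> carrier (free_vs X)"
    using P(2) assms by (intro span_is_subset) simp_all
  then show "span R \<subseteq> P" by simp
qed

text \<open>Every well-definedness statement below is an instance: as the preimage of a
  subspace is a subspace, only the generating relations need to be checked.\<close>

lemma lin_ext_image_span:
  assumes "R \<subseteq> carrier (free_vs X)" "lin_closed N" "\<And>r. r \<in> R \<Longrightarrow> lin_ext g r \<in> N"
  shows "lin_ext g ` LinearCombinations.module.span class_ring (free_vs X) R \<subseteq> N"
  using span_minimal[OF assms(1) lin_closed_vimage[OF assms(2), of g]] assms(3) by blast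

lemma coset_mem: "f \<in> N +>\<^bsub>free_vs X\<^esub> g \<longleftrightarrow> f - g \<in> N"
proof
  assume "f - g \<in> N"
  then show "f \<in> N +>\<^bsub>free_vs X\<^esub> g"
    by (auto simp: a_r_coset_def' intro!: bexI[of _ "f - g"])
qed (auto simp: a_r_coset_def')

lemma coset_eq_iff:
  assumes "lin_closed N"
  shows "N +>\<^bsub>free_vs X\<^esub> f = N +>\<^bsub>free_vs X\<^esub> g \<longleftrightarrow> f - g \<in> N"
proof
  assume "N +>\<^bsub>free_vs X\<^esub> f = N +>\<^bsub>free_vs X\<^esub> g"
  moreover have "f \<in> N +>\<^bsub>free_vs X\<^esub> f"
    using assms by (simp add: coset_mem lin_closedD)
  ultimately show "f - g \<in> N" by (simp add: coset_mem)
next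
  assume fg: "f - g \<in> N"
  have "h - f \<in> N \<longleftrightarrow> h - g \<in> N" for h
    using lin_closed_add[OF assms fg, of "h - f"] lin_closed_diff[OF assms _ fg, of "h - g"]
    by (auto simp: algebra_simps)
  then show "N +>\<^bsub>free_vs X\<^esub> f = N +>\<^bsub>free_vs X\<^esub> g"
    by (auto simp: coset_mem)
qed

text \<open>The union that defines \<^const>\<open>induced_map\<close> is over equal cosets, so one representative
  determines it. Through this fact, all maps out of quotients are computed on representatives.\<close>

lemma induced_map_coset:
  assumes "lin_closed N0" "lin_closed N" "lin_ext g ` N0 \<subseteq> N"
  shows "induced_map (free_vs Y) N (lin_ext g) (N0 +>\<^bsub>free_vs X\<^esub> f) = N +>\<^bsub>free_vs Y\<^esub> lin_ext g f"
proof -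
  have "N +>\<^bsub>free_vs Y\<^esub> lin_ext g a = N +>\<^bsub>free_vs Y\<^esub> lin_ext g f"
    if "a \<in> N0 +>\<^bsub>free_vs X\<^esub> f" for a
    using that assms(3) by (simp add: coset_mem coset_eq_iff[OF assms(2)] image_subset_iff
        flip: lin_ext_diff)
  moreover have "f \<in> N0 +>\<^bsub>free_vs X\<^esub> f"
    using assms(1) by (simp add: coset_mem lin_closedD)
  ultimately show ?thesis
    unfolding induced_map_def by blast
qed

text \<open>The operations on cosets are computed on representatives. Scaling is the map that
  \<^const>\<open>lin_ext\<close> extends from \<open>x \<mapsto> c x\<close>, so that \<open>induced_map_coset\<close> applies to it.\<close>

lemma quotient_vs_simps:
  fixes N :: "('x \<Rightarrow>\<^sub>0 'k::field) set"
  assumes "lin_closed N"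
  shows "carrier (quotient_vs (free_vs X) N) = (\<lambda>f. N +>\<^bsub>free_vs X\<^esub> f) ` {f. Poly_Mapping.keys f \<subseteq> X}"
    and "zero (quotient_vs (free_vs X) N) = N +>\<^bsub>free_vs X\<^esub> 0"
    and "(N +>\<^bsub>free_vs X\<^esub> f) \<oplus>\<^bsub>quotient_vs (free_vs X) N\<^esub> (N +>\<^bsub>free_vs X\<^esub> g) = N +>\<^bsub>free_vs X\<^esub> (f + g)"
    and "c \<odot>\<^bsub>quotient_vs (free_vs X) N\<^esub> (N +>\<^bsub>free_vs X\<^esub> f) = N +>\<^bsub>free_vs X\<^esub> scal c f"
proof -
  show "carrier (quotient_vs (free_vs X) N) = (\<lambda>f. N +>\<^bsub>free_vs X\<^esub> f) ` {f. Poly_Mapping.keys f \<subseteq> X}"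
    by (auto simp: quotient_vs_def A_RCOSETS_def')
  show "zero (quotient_vs (free_vs X) N) = N +>\<^bsub>free_vs X\<^esub> 0"
    by (auto simp: quotient_vs_def coset_mem)
  have "h \<in> (N +>\<^bsub>free_vs X\<^esub> f) <+>\<^bsub>free_vs X\<^esub> (N +>\<^bsub>free_vs X\<^esub> g) \<longleftrightarrow> h - (f + g) \<in> N" for h
  proof
    assume "h \<in> (N +>\<^bsub>free_vs X\<^esub> f) <+>\<^bsub>free_vs X\<^esub> (N +>\<^bsub>free_vs X\<^esub> g)"
    then obtain a b where "h = a + b" "a - f \<in> N" "b - g \<in> N"
      by (auto simp: set_add_def' coset_mem)
    then show "h - (f + g) \<in> N"
      using lin_closed_add[OF assms, of "a - f" "b - g"] by (simp add: algebra_simps)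
  next
    assume "h - (f + g) \<in> N"
    then show "h \<in> (N +>\<^bsub>free_vs X\<^esub> f) <+>\<^bsub>free_vs X\<^esub> (N +>\<^bsub>free_vs X\<^esub> g)"
      unfolding set_add_def' coset_mem using lin_closed_zero[OF assms]
      by (intro UN_I[of "h - g"] UN_I[of g]) (simp_all add: coset_mem algebra_simps)
  qed
  then have "(N +>\<^bsub>free_vs X\<^esub> f) <+>\<^bsub>free_vs X\<^esub> (N +>\<^bsub>free_vs X\<^esub> g) = N +>\<^bsub>free_vs X\<^esub> (f + g)"
    by (simp only: set_eq_iff coset_mem simp_thms)
  then show "(N +>\<^bsub>free_vs X\<^esub> f) \<oplus>\<^bsub>quotient_vs (free_vs X) N\<^esub> (N +>\<^bsub>free_vs X\<^esub> g) = N +>\<^bsub>free_vs X\<^esub> (f + g)"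
    by (simp add: quotient_vs_def)
  have scal_eq: "(scal c :: ('x \<Rightarrow>\<^sub>0 'k) \<Rightarrow> _) = lin_ext (\<lambda>x. Poly_Mapping.single x c)"
  proof
    fix f :: "'x \<Rightarrow>\<^sub>0 'k"
    show "scal c f = lin_ext (\<lambda>x. Poly_Mapping.single x c) f"
      using lin_ext_scaled[of c "\<lambda>x. Poly_Mapping.single x 1" f] by simp
  qed
  have "induced_map (free_vs X) N (scal c) (N +>\<^bsub>free_vs X\<^esub> f) = N +>\<^bsub>free_vs X\<^esub> scal c f"
    unfolding scal_eq
    by (rule induced_map_coset[OF assms assms])
      (simp add: image_subset_iff lin_closed_scal[OF assms] flip: scal_eq)
  then show "c \<odot>\<^bsub>quotient_vs (free_vs X) N\<^esub> (N +>\<^bsub>free_vs X\<^esub> f) = N +>\<^bsub>free_vs X\<^esub> scal c f"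
    by (simp add: quotient_vs_def)
qed

lemma vectorspace_quotient_vs:
  fixes N :: "('x \<Rightarrow>\<^sub>0 'k::field) set"
  assumes N: "lin_closed N"
  shows "vectorspace class_ring (quotient_vs (free_vs X) N)"
proof (rule vs_criteria, rule class_field, goal_cases)
  case 3
  show ?case
  proof
    fix v assume "v \<in> carrier (quotient_vs (free_vs X) N)"
    then obtain f where "v = N +>\<^bsub>free_vs X\<^esub> f" "Poly_Mapping.keys f \<subseteq> X"
      by (auto simp: quotient_vs_simps[OF N])
    then show "\<exists>w\<in>carrier (quotient_vs (free_vs X) N).
        v \<oplus>\<^bsub>quotient_vs (free_vs X) N\<^esub> w = \<zero>\<^bsub>quotient_vs (free_vs X) N\<^esub>"
      by (intro bexI[of _ "N +>\<^bsub>free_vs X\<^esub> (- f)"])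
        (simp_all add: quotient_vs_simps[OF N] in_keys_iff subset_iff)
  qed
qed (use lin_closedD(1-3)[OF lin_closed_carrier[of X, where 'b='k]] in
      \<open>auto simp: quotient_vs_simps[OF N] scal_algebra ac_simps\<close>)

section \<open>Tensor products\<close>

lemma bilinear_relations_carrier:
  fixes V :: "('k::field, 'v, 'm) module_scheme" and W :: "('k, 'w, 'n) module_scheme"
  assumes "vectorspace class_ring V" "vectorspace class_ring W"
  shows "bilinear_relations V W \<subseteq> carrier (free_vs (carrier V \<times> carrier W))"
proof -
  define C :: "('v \<times> 'w \<Rightarrow>\<^sub>0 'k) set" where "C = {f. Poly_Mapping.keys f \<subseteq> carrier V \<times> carrier W}"
  have diff: "f \<in> C \<Longrightarrow> g \<in> C \<Longrightarrow> f - g \<in> C" for f g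
    unfolding C_def by (rule lin_closed_diff[OF lin_closed_carrier])
  have single: "x \<in> carrier V \<Longrightarrow> y \<in> carrier W \<Longrightarrow> Poly_Mapping.single (x, y) c \<in> C" for x y c
    by (simp add: C_def)
  show ?thesis
    unfolding bilinear_relations_def free_vs_simps C_def[symmetric]
    by (auto intro!: diff single vectorspace_closed assms)
qed

lemmas lin_closed_bilinear_null =
  lin_closed_span[OF bilinear_relations_carrier, folded bilinear_null_def]

lemmas bilinear_relations_null =
  span_superset[OF bilinear_relations_carrier, folded bilinear_null_def]

lemma bilinear_null_relations:
  assumes "vectorspace class_ring V" "vectorspace class_ring W"
  shows bilinear_null_add_left: "x \<in> carrier V \<Longrightarrow> x' \<in> carrier V \<Longrightarrow> y \<in> carrier W \<Longrightarrow>
      Poly_Mapping.single (x \<oplus>\<^bsub>V\<^esub> x', y) 1 - Poly_Mapping.single (x, y) 1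
        - Poly_Mapping.single (x', y) 1 \<in> bilinear_null V W"
    and bilinear_null_add_right: "x \<in> carrier V \<Longrightarrow> y \<in> carrier W \<Longrightarrow> y' \<in> carrier W \<Longrightarrow>
      Poly_Mapping.single (x, y \<oplus>\<^bsub>W\<^esub> y') 1 - Poly_Mapping.single (x, y) 1
        - Poly_Mapping.single (x, y') 1 \<in> bilinear_null V W"
    and bilinear_null_smult_left: "x \<in> carrier V \<Longrightarrow> y \<in> carrier W \<Longrightarrow>
      Poly_Mapping.single (c \<odot>\<^bsub>V\<^esub> x, y) 1 - Poly_Mapping.single (x, y) c \<in> bilinear_null V W"
    and bilinear_null_smult_right: "x \<in> carrier V \<Longrightarrow> y \<in> carrier W \<Longrightarrow>
      Poly_Mapping.single (x, c \<odot>\<^bsub>W\<^esub> y) 1 - Poly_Mapping.single (x, y) c \<in> bilinear_null V W"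
  by (rule subsetD[OF bilinear_relations_null[OF assms]], unfold bilinear_relations_def, blast)+

lemma lin_ext_bilinear_null:
  assumes "vectorspace class_ring V" "vectorspace class_ring W" "lin_closed N"
    and "\<And>x x' y. x \<in> carrier V \<Longrightarrow> x' \<in> carrier V \<Longrightarrow> y \<in> carrier W \<Longrightarrow>
      g (x \<oplus>\<^bsub>V\<^esub> x', y) - g (x, y) - g (x', y) \<in> N"
    and "\<And>x y y'. x \<in> carrier V \<Longrightarrow> y \<in> carrier W \<Longrightarrow> y' \<in> carrier W \<Longrightarrow>
      g (x, y \<oplus>\<^bsub>W\<^esub> y') - g (x, y) - g (x, y') \<in> N"
    and "\<And>c x y. x \<in> carrier V \<Longrightarrow> y \<in> carrier W \<Longrightarrow> g (c \<odot>\<^bsub>V\<^esub> x, y) - scal c (g (x, y)) \<in> N"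
    and "\<And>c x y. x \<in> carrier V \<Longrightarrow> y \<in> carrier W \<Longrightarrow> g (x, c \<odot>\<^bsub>W\<^esub> y) - scal c (g (x, y)) \<in> N"
  shows "lin_ext g ` bilinear_null V W \<subseteq> N"
  unfolding bilinear_null_def
proof (rule lin_ext_image_span[OF bilinear_relations_carrier[OF assms(1,2)] assms(3)])
  fix r
  assume "r \<in> bilinear_relations V W"
  then show "lin_ext g r \<in> N"
    unfolding bilinear_relations_def using assms(4-)
    by (elim UnE CollectE exE conjE) (simp_all add: lin_ext_diff scal_one)
qed

lemma tensor_class_carrier:
  assumes "vectorspace class_ring V" "vectorspace class_ring W"
    "Poly_Mapping.keys f \<subseteq> carrier V \<times> carrier W"
  shows "tensor_class V W f \<in> carrier (tensor_product V W)"
  unfolding tensor_class_def tensor_product_def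
    quotient_vs_simps(1)[OF lin_closed_bilinear_null[OF assms(1,2)]]
  using assms(3) by (intro imageI CollectI)

text \<open>Tensor products see only the vector space structure, so the coalgebra records may be
  replaced by the underlying vector spaces.\<close>

lemma tensor_cong:
  assumes "carrier M' = carrier M" "add M' = add M" "smult M' = smult M"
  shows "tensor_class M' M' = tensor_class M M" "tensor_product M' M' = tensor_product M M"
  by (intro ext, simp_all add: assms tensor_class_def tensor_product_def bilinear_null_def
      bilinear_relations_def)

text \<open>The map \<open>\<phi> \<otimes> \<psi>\<close> may be computed on any formal sum of pairs that
  represents a tensor, because linearity of \<open>\<phi>\<close> and \<open>\<psi>\<close> sends each bilinear relation to one of the
  same kind.\<close>

lemma tensor_map_tensor_class:
  assumes C: "vectorspace class_ring C" "vectorspace class_ring C'"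
    and D: "vectorspace class_ring D" "vectorspace class_ring D'"
    and hom: "\<phi> \<in> lin_hom C D" "\<psi> \<in> lin_hom C' D'"
  shows "tensor_map D D' \<phi> \<psi> (tensor_class C C' f)
    = tensor_class D D' (lin_ext (\<lambda>(x, y). Poly_Mapping.single (\<phi> x, \<psi> y) 1) f)"
  unfolding tensor_map_def tensor_class_def
proof (rule induced_map_coset)
  show "lin_closed (bilinear_null C C')" "lin_closed (bilinear_null D D')"
    by (intro lin_closed_bilinear_null C D)+
  show "lin_ext (\<lambda>(x, y). Poly_Mapping.single (\<phi> x, \<psi> y) 1) ` bilinear_null C C'
      \<subseteq> bilinear_null D D'"
  proof (rule lin_ext_bilinear_null[OF C])
    show "lin_closed (bilinear_null D D')"
      by (intro lin_closed_bilinear_null D)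
  qed (use module_hom_closed[OF hom(1)] module_hom_closed[OF hom(2)] in
      \<open>simp_all add: Pi_iff bilinear_null_relations[OF D] module_hom_smult[OF hom(1)]
        module_hom_smult[OF hom(2)] LinearCombinations.module_hom_add[OF hom(1)]
        LinearCombinations.module_hom_add[OF hom(2)]\<close>)
qed

section \<open>Tensor powers and deconcatenation\<close>

lemma multilinear_relations_carrier:
  fixes V :: "('k::field, 'v, 'm) module_scheme"
  assumes "vectorspace class_ring V"
  shows "multilinear_relations V \<subseteq> carrier (free_vs (lists (carrier V)))"
proof -
  define C :: "('v list \<Rightarrow>\<^sub>0 'k) set" where "C = {f. Poly_Mapping.keys f \<subseteq> lists (carrier V)}"
  have diff: "f \<in> C \<Longrightarrow> g \<in> C \<Longrightarrow> f - g \<in> C" for f g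
    unfolding C_def by (rule lin_closed_diff[OF lin_closed_carrier])
  have single: "us \<in> lists (carrier V) \<Longrightarrow> x \<in> carrier V \<Longrightarrow> ws \<in> lists (carrier V)
      \<Longrightarrow> Poly_Mapping.single (us @ x # ws) c \<in> C" for us x ws c
    by (simp add: C_def)
  show ?thesis
    unfolding multilinear_relations_def free_vs_simps C_def[symmetric]
    by (auto intro!: diff single vectorspace_closed assms)
qed

lemmas lin_closed_multilinear_null =
  lin_closed_span[OF multilinear_relations_carrier, folded multilinear_null_def]

lemmas multilinear_relations_null =
  span_superset[OF multilinear_relations_carrier, folded multilinear_null_def]

lemmas multilinear_null_minimal =
  span_minimal[OF multilinear_relations_carrier, folded multilinear_null_def]

lemma multilinear_null_relations:
  assumes "vectorspace class_ring V" "us \<in> lists (carrier V)" "ws \<in> lists (carrier V)"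
  shows multilinear_null_add: "x \<in> carrier V \<Longrightarrow> y \<in> carrier V \<Longrightarrow>
      Poly_Mapping.single (us @ (x \<oplus>\<^bsub>V\<^esub> y) # ws) 1 - Poly_Mapping.single (us @ x # ws) 1
        - Poly_Mapping.single (us @ y # ws) 1 \<in> multilinear_null V"
    and multilinear_null_smult: "x \<in> carrier V \<Longrightarrow>
      Poly_Mapping.single (us @ (c \<odot>\<^bsub>V\<^esub> x) # ws) 1 - Poly_Mapping.single (us @ x # ws) c
        \<in> multilinear_null V"
  using assms(2,3)
  by - (rule subsetD[OF multilinear_relations_null[OF assms(1)]],
      unfold multilinear_relations_def, blast)+

lemma lin_ext_multilinear_null:
  assumes "vectorspace class_ring V" "lin_closed N"
    and "\<And>us x y ws. us \<in> lists (carrier V) \<Longrightarrow> x \<in> carrier V \<Longrightarrow> y \<in> carrier V \<Longrightarrow>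
      ws \<in> lists (carrier V) \<Longrightarrow> g (us @ (x \<oplus>\<^bsub>V\<^esub> y) # ws) - g (us @ x # ws) - g (us @ y # ws) \<in> N"
    and "\<And>us c x ws. us \<in> lists (carrier V) \<Longrightarrow> x \<in> carrier V \<Longrightarrow> ws \<in> lists (carrier V) \<Longrightarrow>
      g (us @ (c \<odot>\<^bsub>V\<^esub> x) # ws) - scal c (g (us @ x # ws)) \<in> N"
  shows "lin_ext g ` multilinear_null V \<subseteq> N"
  unfolding multilinear_null_def
proof (rule lin_ext_image_span[OF multilinear_relations_carrier[OF assms(1)] assms(2)])
  fix r
  assume "r \<in> multilinear_relations V"
  then show "lin_ext g r \<in> N"
    unfolding multilinear_relations_def using assms(3-)
    by (elim UnE CollectE exE conjE) (simp_all add: lin_ext_diff scal_one)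
qed

text \<open>This makes the counit of the cofree coalgebra well defined: a relation consists
  of words that contain the altered letter, hence of nonempty words.\<close>

lemma lookup_Nil_multilinear_null:
  assumes "vectorspace class_ring V" "f \<in> multilinear_null V"
  shows "Poly_Mapping.lookup f [] = 0"
proof -
  have "multilinear_null V \<subseteq> {f. Poly_Mapping.lookup f [] = 0}"
    by (rule multilinear_null_minimal[OF assms(1)])
      (auto simp: lin_closed_def lookup_add lookup_minus lookup_single multilinear_relations_def)
  then show ?thesis
    using assms(2) by blast
qed

lemma vectorspace_tensor_powers:
  "vectorspace class_ring V \<Longrightarrow> vectorspace class_ring (tensor_powers V)"
  unfolding tensor_powers_def by (intro vectorspace_quotient_vs lin_closed_multilinear_null)

lemma pure_tensor_carrier:
  assumes "vectorspace class_ring V" "vs \<in> lists (carrier V)"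
  shows "pure_tensor V vs \<in> carrier (tensor_powers V)"
  using assms(2)
  by (simp add: pure_tensor_def tensor_powers_def quotient_vs_simps lin_closed_multilinear_null assms(1))

lemma pure_tensor_add:
  assumes "vectorspace class_ring V" "us \<in> lists (carrier V)" "ws \<in> lists (carrier V)"
    "x \<in> carrier V" "y \<in> carrier V"
  shows "pure_tensor V (us @ (x \<oplus>\<^bsub>V\<^esub> y) # ws)
    = pure_tensor V (us @ x # ws) \<oplus>\<^bsub>tensor_powers V\<^esub> pure_tensor V (us @ y # ws)"
  using multilinear_null_add[OF assms]
  by (simp add: pure_tensor_def tensor_powers_def quotient_vs_simps lin_closed_multilinear_null
      assms(1) coset_eq_iff diff_diff_eq)

lemma pure_tensor_smult:
  assumes "vectorspace class_ring V" "us \<in> lists (carrier V)" "ws \<in> lists (carrier V)"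
    "x \<in> carrier V"
  shows "pure_tensor V (us @ (c \<odot>\<^bsub>V\<^esub> x) # ws) = c \<odot>\<^bsub>tensor_powers V\<^esub> pure_tensor V (us @ x # ws)"
  using multilinear_null_smult[OF assms]
  by (simp add: pure_tensor_def tensor_powers_def quotient_vs_simps lin_closed_multilinear_null
      assms(1) coset_eq_iff)

text \<open>Deconcatenation respects the multilinear relations. A relation alters a single
  letter of a word, and each cut of the word leaves that letter in exactly one of the two factors; the
  relation then holds for the pure tensor in that factor, and bilinearity carries it to the cut
  word.\<close>

lemma deconcatenation_coset:
  assumes V: "vectorspace class_ring V"
  shows "deconcatenation V (multilinear_null V +>\<^bsub>free_vs (lists (carrier V))\<^esub> f)
    = tensor_class (tensor_powers V) (tensor_powers V) (lin_ext (\<lambda>vs. \<Sum>i\<le>length vs.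
        Poly_Mapping.single (pure_tensor V (take i vs), pure_tensor V (drop i vs)) 1) f)"
  unfolding deconcatenation_def tensor_class_def
proof (rule induced_map_coset)
  let ?T = "tensor_powers V"
  let ?N = "bilinear_null ?T ?T"
  let ?P = "\<lambda>vs i. Poly_Mapping.single (pure_tensor V (take i vs), pure_tensor V (drop i vs)) 1"
  have T: "vectorspace class_ring ?T" by (rule vectorspace_tensor_powers[OF V])
  show closed: "lin_closed ?N" and "lin_closed (multilinear_null V)"
    by (intro lin_closed_bilinear_null lin_closed_multilinear_null V T)+
  note pure = pure_tensor_carrier[OF V] pure_tensor_add[OF V] pure_tensor_smult[OF V]
  have lists: "take i us \<in> lists (carrier V)" "drop i us \<in> lists (carrier V)"
    if "us \<in> lists (carrier V)" for us i
    using that by (auto dest: in_set_takeD in_set_dropD)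
  show "lin_ext (\<lambda>vs. \<Sum>i\<le>length vs. ?P vs i) ` multilinear_null V \<subseteq> ?N"
  proof (rule lin_ext_multilinear_null[OF V closed])
    fix us x y ws
    assume xy: "us \<in> lists (carrier V)" "x \<in> carrier V" "y \<in> carrier V" "ws \<in> lists (carrier V)"
    have "?P (us @ (x \<oplus>\<^bsub>V\<^esub> y) # ws) i - ?P (us @ x # ws) i - ?P (us @ y # ws) i \<in> ?N" for i
    \<comment> \<open>The cut at \<open>i\<close> leaves the altered letter in the right factor iff \<open>i \<le> length us\<close>.\<close>
    proof (cases "i \<le> length us")
      case True
      then show ?thesis
        using xy lists[OF xy(1)] by (simp add: pure bilinear_null_add_right[OF T T])
    next
      case False
      then show ?thesis
        using xy lists[OF xy(4)] by (simp add: take_Cons' drop_Cons' pure bilinear_null_add_left[OF T T])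
    qed
    then show "(\<Sum>i\<le>length (us @ (x \<oplus>\<^bsub>V\<^esub> y) # ws). ?P (us @ (x \<oplus>\<^bsub>V\<^esub> y) # ws) i)
        - (\<Sum>i\<le>length (us @ x # ws). ?P (us @ x # ws) i)
        - (\<Sum>i\<le>length (us @ y # ws). ?P (us @ y # ws) i) \<in> ?N"
      by (simp only: length_append list.size flip: sum_subtractf) (rule lin_closed_sum[OF closed])
  next
    fix us c x ws
    assume x: "us \<in> lists (carrier V)" "x \<in> carrier V" "ws \<in> lists (carrier V)"
    have "?P (us @ (c \<odot>\<^bsub>V\<^esub> x) # ws) i - scal c (?P (us @ x # ws) i) \<in> ?N" for i
    proof (cases "i \<le> length us")
      case True
      then show ?thesis
        using x lists[OF x(1)] by (simp add: pure bilinear_null_smult_right[OF T T])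
    next
      case False
      then show ?thesis
        using x lists[OF x(3)] by (simp add: take_Cons' drop_Cons' pure bilinear_null_smult_left[OF T T])
    qed
    then show "(\<Sum>i\<le>length (us @ (c \<odot>\<^bsub>V\<^esub> x) # ws). ?P (us @ (c \<odot>\<^bsub>V\<^esub> x) # ws) i)
        - scal c (\<Sum>i\<le>length (us @ x # ws). ?P (us @ x # ws) i) \<in> ?N"
      by (simp only: length_append list.size scal_sum flip: sum_subtractf)
        (rule lin_closed_sum[OF closed])
  qed
qed

lemma cofree_coalgebra_simps:
  "carrier (cofree_coalgebra V) = carrier (tensor_powers V)"
  "zero (cofree_coalgebra V) = zero (tensor_powers V)"
  "add (cofree_coalgebra V) = add (tensor_powers V)"
  "smult (cofree_coalgebra V) = smult (tensor_powers V)"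
  "comult (cofree_coalgebra V) = deconcatenation V"
  by (simp_all add: cofree_coalgebra_def module.extend_def coalgebra.fields_def)

section \<open>The words in a basis as a basis of the tensor powers\<close>

text \<open>A letter stands for the basis vector that it indexes, so a word in the letters becomes a
  word of vectors.\<close>

abbreviation letter_word :: "'x list \<Rightarrow> ('x \<Rightarrow>\<^sub>0 'k::field) list" where
  "letter_word \<equiv> map (\<lambda>x. Poly_Mapping.single x 1)"

lemma letter_word_lists: "ws \<in> lists L \<Longrightarrow> letter_word ws \<in> lists (carrier (free_vs L))"
  by auto

lemma inj_letter_word: "inj_on (letter_word :: 'x list \<Rightarrow> ('x \<Rightarrow>\<^sub>0 'k::field) list) A"
proof -
  have "inj (\<lambda>x::'x. Poly_Mapping.single x (1::'k))"
  proof (rule injI)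
    fix x y :: 'x
    assume "Poly_Mapping.single x (1::'k) = Poly_Mapping.single y 1"
    then have "Poly_Mapping.keys (Poly_Mapping.single x (1::'k))
        = Poly_Mapping.keys (Poly_Mapping.single y (1::'k))"
      by (rule arg_cong)
    then show "x = y" by simp
  qed
  then show ?thesis
    by (intro inj_on_subset[OF inj_mapI]) simp_all
qed

text \<open>The multilinear expansion of a product of vectors into words in the basis letters. Its
  linear extension vanishes on the multilinear relations, which makes it the inverse of the map that
  sends a word in the letters to the corresponding pure tensor.\<close>

fun expand :: "('x \<Rightarrow>\<^sub>0 'k::field) list \<Rightarrow> ('x list \<Rightarrow>\<^sub>0 'k)" where
  "expand [] = Poly_Mapping.single [] 1"
| "expand (v # vs) = lin_ext (\<lambda>x. lin_ext (\<lambda>w. Poly_Mapping.single (x # w) 1) (expand vs)) v"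

lemma keys_expand: "vs \<in> lists (carrier (free_vs L)) \<Longrightarrow> Poly_Mapping.keys (expand vs) \<subseteq> lists L"
proof (induction vs)
  case (Cons v vs)
  then have "Poly_Mapping.keys v \<subseteq> L" and "Poly_Mapping.keys (expand vs) \<subseteq> lists L"
    by auto
  then have "x # w \<in> lists L" if "x \<in> Poly_Mapping.keys v" "w \<in> Poly_Mapping.keys (expand vs)" for x w
    using that by (meson Cons_in_lists_iff subsetD)
  then show ?case
    unfolding expand.simps by (intro keys_lin_ext) simp
qed simp

lemma expand_letter_word: "expand (letter_word ws) = Poly_Mapping.single ws 1"
  by (induction ws) (simp_all add: scal_algebra)

lemma expand_add: "expand (us @ (x + y) # ws) = expand (us @ x # ws) + expand (us @ y # ws)"
  by (induction us) (simp_all add: lin_ext_add lin_ext_plus)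

lemma expand_scal: "expand (us @ scal c x # ws) = scal c (expand (us @ x # ws))"
  by (induction us) (simp_all add: lin_ext_scal lin_ext_scaled)

lemma lin_ext_expand_null: "lin_ext expand ` multilinear_null (free_vs L) \<subseteq> {0}"
  by (rule lin_ext_multilinear_null[OF vectorspace_free_vs])
    (simp_all add: lin_closed_def expand_add expand_scal scal_zero)

text \<open>Tensoring with \<open>v\<close> on the left is well defined on tensor powers; it lifts a
  congruence of words to the words with \<open>v\<close> in front.\<close>

lemma single_Cons_null:
  assumes V: "vectorspace class_ring V" and v: "v \<in> carrier V"
  shows "lin_ext (\<lambda>vs. Poly_Mapping.single (v # vs) 1) ` multilinear_null V \<subseteq> multilinear_null V"
proof (rule lin_ext_multilinear_null[OF V lin_closed_multilinear_null[OF V]])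
  show "Poly_Mapping.single (v # us @ (x \<oplus>\<^bsub>V\<^esub> y) # ws) 1 - Poly_Mapping.single (v # us @ x # ws) 1
      - Poly_Mapping.single (v # us @ y # ws) 1 \<in> multilinear_null V"
    if "us \<in> lists (carrier V)" "x \<in> carrier V" "y \<in> carrier V" "ws \<in> lists (carrier V)" for us x y ws
    using multilinear_null_add[OF V, of "v # us" ws x y] that v by simp
  show "Poly_Mapping.single (v # us @ (c \<odot>\<^bsub>V\<^esub> x) # ws) 1
      - scal c (Poly_Mapping.single (v # us @ x # ws) 1) \<in> multilinear_null V"
    if "us \<in> lists (carrier V)" "x \<in> carrier V" "ws \<in> lists (carrier V)" for us c x ws
    using multilinear_null_smult[OF V, of "v # us" ws x c] that v by simp
qed

text \<open>Linearity in the first letter. Both sides depend linearly on \<open>v\<close> modulo the relations and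
  agree when \<open>v\<close> is a basis vector.\<close>

lemma expand_head:
  assumes "v \<in> carrier (free_vs L)" "ws \<in> lists (carrier (free_vs L))"
  shows "Poly_Mapping.single (v # ws) 1
      - lin_ext (\<lambda>x. Poly_Mapping.single (Poly_Mapping.single x 1 # ws) 1) v
    \<in> multilinear_null (free_vs L :: ('k::field, 'x \<Rightarrow>\<^sub>0 'k) module)" (is "?d v \<in> ?N")
proof -
  note V = vectorspace_free_vs[of L, where 'k='k]
  note N = lin_closed_multilinear_null[OF V]
  let ?C = "carrier (free_vs L :: ('k, 'x \<Rightarrow>\<^sub>0 'k) module)"
  have C: "lin_closed ?C"
    using lin_closed_carrier by simp
  \<comment> \<open>The relation that scales a letter by 0 makes a word with the letter 0 a null element.\<close>
  have 0: "?d 0 \<in> ?N"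
    using multilinear_null_smult[OF V, of "[]" ws 0 0] assms(2) by (simp add: scal_algebra)
  have add: "?d (v + w) \<in> ?N" if "v \<in> ?C" "w \<in> ?C" "?d v \<in> ?N" "?d w \<in> ?N" for v w
    using lin_closed_add[OF N multilinear_null_add[OF V, of "[]" ws v w] lin_closed_add[OF N that(3,4)]]
      that(1,2) assms(2) by (simp add: lin_ext_add algebra_simps)
  have smult: "?d (scal c v) \<in> ?N" if "v \<in> ?C" "?d v \<in> ?N" for c v
    using lin_closed_add[OF N multilinear_null_smult[OF V, of "[]" ws v c] lin_closed_scal[OF N that(2), of c]]
      that(1) assms(2) by (simp add: lin_ext_scal scal_diff)
  have closed: "lin_closed {v \<in> ?C. ?d v \<in> ?N}"
    unfolding lin_closed_def
    by (intro conjI ballI allI CollectI; (elim CollectE conjE)?;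
        (rule 0 add smult lin_closedD(1-3)[OF C]; assumption?))
  have letter: "Poly_Mapping.single x 1 \<in> {v \<in> ?C. ?d v \<in> ?N}" if "x \<in> L" for x
    using that lin_closed_zero[OF N] by (simp add: scal_algebra)
  have "v \<in> {v \<in> ?C. ?d v \<in> ?N}"
    by (rule free_vs_induct[OF closed letter]) (use assms(1) in simp_all)
  then show ?thesis by simp
qed

text \<open>Words in the basis letters span the tensor powers. By induction on the length, the
  tail is expanded behind \<open>v\<close> and \<open>v\<close> is then expanded in front of each word of the result.\<close>

lemma expand_congruent:
  assumes "vs \<in> lists (carrier (free_vs L))"
  shows "Poly_Mapping.single vs 1 - lin_ext (\<lambda>w. Poly_Mapping.single (letter_word w) 1) (expand vs)
    \<in> multilinear_null (free_vs L :: ('k::field, 'x \<Rightarrow>\<^sub>0 'k) module)"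
  using assms
proof (induction vs)
  note V = vectorspace_free_vs[of L, where 'k='k]
  note N = lin_closed_multilinear_null[OF V]
  case Nil
  then show ?case
    using lin_closed_zero[OF N] by (simp add: scal_algebra)
next
  note V = vectorspace_free_vs[of L, where 'k='k]
  note N = lin_closed_multilinear_null[OF V]
  case (Cons v vs)
  let ?S = "\<lambda>w. Poly_Mapping.single w (1::'k)"
  have v: "v \<in> carrier (free_vs L)" and vs: "vs \<in> lists (carrier (free_vs L))"
    using Cons.hyps by blast+
  have "lin_ext (\<lambda>ws. ?S (v # ws)) (?S vs - lin_ext (\<lambda>w. ?S (letter_word w)) (expand vs))
      \<in> multilinear_null (free_vs L)"
    using single_Cons_null[OF V v] Cons.IH by blast
  then have 1: "?S (v # vs) - lin_ext (\<lambda>w. ?S (v # letter_word w)) (expand vs)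
      \<in> multilinear_null (free_vs L)"
    by (simp add: lin_ext_diff lin_ext_lin_ext scal_algebra)
  have 2: "lin_ext (\<lambda>w. ?S (v # letter_word w) - lin_ext (\<lambda>x. ?S (?S x # letter_word w)) v) (expand vs)
      \<in> multilinear_null (free_vs L)"
    using keys_expand[OF vs] by (intro lin_closed_lin_ext[OF N] expand_head v letter_word_lists) blast
  have swap: "lin_ext (\<lambda>w. lin_ext (\<lambda>x. ?S (?S x # letter_word w)) v) (expand vs)
      = lin_ext (\<lambda>w. ?S (letter_word w)) (expand (v # vs))"
    by (simp add: lin_ext_swap[of _ v] lin_ext_lin_ext scal_algebra)
  from lin_closed_add[OF N 1 2] show ?case
    by (simp only: lin_ext_minus swap) simp
qed

text \<open>The linear map from the free vector space on the words over \<open>L\<close> to the tensor powers of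
  the free vector space on \<open>L\<close>, sending a word to the pure tensor of its letters.\<close>

definition word_tensor :: "'x set \<Rightarrow> ('x list \<Rightarrow>\<^sub>0 'k::field) \<Rightarrow> (('x \<Rightarrow>\<^sub>0 'k) list \<Rightarrow>\<^sub>0 'k) set" where
  "word_tensor L f = multilinear_null (free_vs L) +>\<^bsub>free_vs (lists (carrier (free_vs L)))\<^esub>
     lin_ext (\<lambda>ws. Poly_Mapping.single (letter_word ws) 1) f"

lemma word_tensor_hom:
  "word_tensor L \<in> lin_hom (free_vs (lists L))
     (tensor_powers (free_vs L) :: ('k::field, (('x \<Rightarrow>\<^sub>0 'k) list \<Rightarrow>\<^sub>0 'k) set) module)"
proof -
  let ?V = "free_vs L :: ('k, 'x \<Rightarrow>\<^sub>0 'k) module"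
  define X where "X = lists (carrier ?V)"
  note q = quotient_vs_simps[OF lin_closed_multilinear_null[OF vectorspace_free_vs[of L, where 'k='k]], of X]
  have "Poly_Mapping.keys (lin_ext (\<lambda>ws. Poly_Mapping.single (letter_word ws) (1::'k)) f)
      \<subseteq> X"
    if "Poly_Mapping.keys f \<subseteq> lists L" for f :: "'x list \<Rightarrow>\<^sub>0 'k"
  proof (rule keys_lin_ext)
    fix ws assume "ws \<in> Poly_Mapping.keys f"
    then have "letter_word ws \<in> lists (carrier ?V)"
      using that by (intro letter_word_lists) blast
    then show "Poly_Mapping.keys (Poly_Mapping.single (letter_word ws) (1::'k))
        \<subseteq> X"
      by (simp add: X_def)
  qed
  then show ?thesis
    unfolding LinearCombinations.module_hom_def tensor_powers_def word_tensor_def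
      X_def[symmetric]
    by (simp add: q lin_ext_add lin_ext_scal Pi_iff)
qed

text \<open>Injectivity holds because \<^const>\<open>expand\<close> recovers a combination of words and
  vanishes on the relations, surjectivity because every word of vectors is congruent to its
  expansion.\<close>

lemma word_tensor_bij:
  "bij_betw (word_tensor L) (carrier (free_vs (lists L)))
     (carrier (tensor_powers (free_vs L :: ('k::field, 'x \<Rightarrow>\<^sub>0 'k) module)))"
proof (rule bij_betw_imageI)
  let ?V = "free_vs L :: ('k, 'x \<Rightarrow>\<^sub>0 'k) module"
  note N = lin_closed_multilinear_null[OF vectorspace_free_vs[of L, where 'k='k]]
  let ?W = "\<lambda>f. lin_ext (\<lambda>ws. Poly_Mapping.single (letter_word ws) (1::'k)) f"
  have expand_W: "lin_ext expand (?W f) = f" for f :: "'x list \<Rightarrow>\<^sub>0 'k"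
    by (simp add: lin_ext_lin_ext expand_letter_word scal_algebra)
  show "inj_on (word_tensor L) (carrier (free_vs (lists L)) :: ('x list \<Rightarrow>\<^sub>0 'k) set)"
  proof
    fix f g :: "'x list \<Rightarrow>\<^sub>0 'k"
    assume "word_tensor L f = word_tensor L g"
    then have "?W (f - g) \<in> multilinear_null (free_vs L)"
      by (simp add: word_tensor_def coset_eq_iff[OF N] lin_ext_diff)
    then have "lin_ext expand (?W (f - g)) = 0"
      using lin_ext_expand_null[of L] by blast
    then show "f = g"
      by (simp add: expand_W)
  qed
  have "\<exists>f\<in>carrier (free_vs (lists L)). word_tensor L f
      = multilinear_null (free_vs L) +>\<^bsub>free_vs (lists (carrier (free_vs L)))\<^esub> g"
    if g: "Poly_Mapping.keys g \<subseteq> lists (carrier (free_vs L))" for g :: "('x \<Rightarrow>\<^sub>0 'k) list \<Rightarrow>\<^sub>0 'k"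
  proof
    have mem: "vs \<in> lists (carrier (free_vs L))" if "vs \<in> Poly_Mapping.keys g" for vs
      using g that by (rule subsetD)
    show "lin_ext expand g \<in> carrier (free_vs (lists L))"
      using keys_lin_ext[of g expand "lists L"] keys_expand[OF mem] by simp
    have "lin_ext (\<lambda>vs. Poly_Mapping.single vs 1 - ?W (expand vs)) g \<in> multilinear_null (free_vs L)"
      by (intro lin_closed_lin_ext[OF N] expand_congruent mem)
    then have "g - ?W (lin_ext expand g) \<in> multilinear_null (free_vs L)"
      by (simp add: lin_ext_minus lin_ext_lin_ext)
    from lin_closed_diff[OF N lin_closed_zero[OF N] this] show "word_tensor L (lin_ext expand g)
        = multilinear_null (free_vs L) +>\<^bsub>free_vs (lists (carrier (free_vs L)))\<^esub> g"
      by (simp add: word_tensor_def coset_eq_iff[OF N])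
  qed
  then have "carrier (tensor_powers ?V)
      \<subseteq> word_tensor L ` (carrier (free_vs (lists L)) :: ('x list \<Rightarrow>\<^sub>0 'k) set)"
    unfolding tensor_powers_def quotient_vs_simps(1)[OF N] by fast
  moreover have "word_tensor L ` carrier (free_vs (lists L)) \<subseteq> carrier (tensor_powers ?V)"
    using module_hom_closed[OF word_tensor_hom[of L, where 'k='k]] by blast
  ultimately show "word_tensor L ` carrier (free_vs (lists L))
      = carrier (tensor_powers ?V)"
    by (rule equalityI[rotated])
qed

lemma deconcatenation_word_tensor:
  fixes f :: "'x list \<Rightarrow>\<^sub>0 'k::field" and L :: "'x set"
  defines "V \<equiv> free_vs L :: ('k, 'x \<Rightarrow>\<^sub>0 'k) module"
  shows "deconcatenation V (word_tensor L f) = tensor_class (tensor_powers V) (tensor_powers V)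
    (lin_ext (\<lambda>ws. \<Sum>i\<le>length ws. Poly_Mapping.single
       (word_tensor L (Poly_Mapping.single (take i ws) 1),
        word_tensor L (Poly_Mapping.single (drop i ws) 1)) 1) f)"
  unfolding V_def word_tensor_def deconcatenation_coset[OF vectorspace_free_vs]
  by (simp add: lin_ext_lin_ext scal_algebra pure_tensor_def take_map drop_map)

lemma counit_word_tensor:
  fixes f :: "'x list \<Rightarrow>\<^sub>0 'k::field"
  shows "counit (cofree_coalgebra (free_vs L)) (word_tensor L f) = Poly_Mapping.lookup f []"
proof -
  let ?g = "lin_ext (\<lambda>ws. Poly_Mapping.single (letter_word ws) 1) f :: ('x \<Rightarrow>\<^sub>0 'k) list \<Rightarrow>\<^sub>0 'k"
  have *: "Poly_Mapping.lookup h [] = Poly_Mapping.lookup ?g []" if "h \<in> word_tensor L f" for h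
    using lookup_Nil_multilinear_null[OF vectorspace_free_vs, of "h - ?g" L] that
    by (simp add: word_tensor_def coset_mem lookup_minus)
  have g: "?g \<in> word_tensor L f"
    using lin_closed_zero[OF lin_closed_multilinear_null[OF vectorspace_free_vs]]
    by (simp add: word_tensor_def coset_mem)
  have "(THE c. \<forall>h\<in>word_tensor L f. Poly_Mapping.lookup h [] = c) = Poly_Mapping.lookup ?g []"
  proof (rule the_equality)
    show "\<forall>h\<in>word_tensor L f. Poly_Mapping.lookup h [] = Poly_Mapping.lookup ?g []"
      using * by (rule ballI)
    show "c = Poly_Mapping.lookup ?g []" if "\<forall>h\<in>word_tensor L f. Poly_Mapping.lookup h [] = c" for c
      using bspec[OF that g] by (rule sym)
  qed
  also have "\<dots> = Poly_Mapping.lookup f []"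
    using lookup_lin_ext_single[OF inj_letter_word, of f UNIV "[]"] by simp
  finally show ?thesis
    by (simp add: cofree_coalgebra_def module.extend_def coalgebra.fields_def)
qed

section \<open>Faces as words in two letters\<close>

text \<open>The two faces of degree 1. They index a basis of \<open>V\<close>, the space on which the coalgebra of
  faces is cofree.\<close>

definition vertices :: "(nat \<times> nat set) set" where
  "vertices = {(1, {}), (1, {1})}"

text \<open>The indicator word of \<open>S\<close> in \<open>[n]\<close>: position \<open>i\<close>, counted from 0, holds the letter
  \<open>(1, {1})\<close> if \<open>i + 1 \<in> S\<close> and \<open>(1, {})\<close> otherwise.\<close>

definition face_word :: "nat \<times> nat set \<Rightarrow> (nat \<times> nat set) list" where
  "face_word = (\<lambda>(n, S). map (\<lambda>i. (1, if Suc i \<in> S then {1} else {})) [0..<n])"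

lemma face_word_bij: "bij_betw face_word faces (lists vertices)"
proof (rule bij_betw_byWitness)
  \<comment> \<open>The inverse shifts positions by one, from the list indices to the elements of \<open>[n]\<close>.\<close>
  let ?v = "\<lambda>ws. (length ws, {j \<in> {1..length ws}. ws ! (j - 1) = (1, {1}) })"
  show "\<forall>b\<in>faces. ?v (face_word b) = b"
    by (force simp: faces_def face_word_def split: if_splits)
  show "\<forall>ws\<in>lists vertices. face_word (?v ws) = ws"
  proof
    fix ws assume "ws \<in> lists vertices"
    then have "ws ! i \<in> vertices" if "i < length ws" for i
      using that by auto
    then have "(1, if ws ! i = (1, {1}) then {1} else {}) = ws ! i" if "i < length ws" for i
      using that by (fastforce simp: vertices_def)
    then show "face_word (?v ws) = ws"
      by (intro nth_equalityI) (simp_all add: face_word_def)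
  qed
  show "face_word ` faces \<subseteq> lists vertices"
    by (auto simp: face_word_def vertices_def split: if_splits)
  show "?v ` lists vertices \<subseteq> faces"
    by (auto simp: faces_def)
qed

lemma length_face_word: "length (face_word (n, S)) = n"
  by (simp add: face_word_def)

text \<open>This fact and the next one are the heart of the matter: the two factors of each term
  in the coproduct of a face are the two pieces of its word, cut after position \<open>p\<close>.\<close>

lemma take_face_word: "p \<le> n \<Longrightarrow> take p (face_word (n, S)) = face_word (p, S \<inter> {1..p})"
  by (rule nth_equalityI) (auto simp: face_word_def)

lemma drop_face_word:
  "p \<le> n \<Longrightarrow> drop p (face_word (n, S)) = face_word (n - p, {j \<in> {1..n - p}. j + p \<in> S})"
  by (rule nth_equalityI) (auto simp: face_word_def add.commute)

lemma DeltaSym_simps: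
  "carrier DeltaSym = carrier (free_vs faces)" "zero DeltaSym = zero (free_vs faces)"
  "add DeltaSym = add (free_vs faces)" "smult DeltaSym = smult (free_vs faces)"
  "comult DeltaSym = DeltaSym_comult" "counit DeltaSym f = Poly_Mapping.lookup f (0, {})"
  by (simp_all add: DeltaSym_def module.extend_def coalgebra.fields_def)

definition face_tensor :: "(nat \<times> nat set \<Rightarrow>\<^sub>0 'k::field)
    \<Rightarrow> ((nat \<times> nat set \<Rightarrow>\<^sub>0 'k) list \<Rightarrow>\<^sub>0 'k) set" where
  "face_tensor f = word_tensor vertices (lin_ext (\<lambda>b. Poly_Mapping.single (face_word b) 1) f)"

theorem corollary6p2:
  shows "cofree (DeltaSym :: ('k::field_char_0, (nat \<times> nat set) \<Rightarrow>\<^sub>0 'k) coalgebra)"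
proof -
  let ?C = "DeltaSym :: ('k, (nat \<times> nat set) \<Rightarrow>\<^sub>0 'k) coalgebra"
  let ?F = "free_vs faces :: ('k, (nat \<times> nat set) \<Rightarrow>\<^sub>0 'k) module"
  let ?V = "free_vs vertices :: ('k, (nat \<times> nat set) \<Rightarrow>\<^sub>0 'k) module"
  let ?T = "tensor_powers ?V"
  let ?D = "cofree_coalgebra ?V"
  let ?\<phi> = "face_tensor :: (nat \<times> nat set \<Rightarrow>\<^sub>0 'k) \<Rightarrow> _"
  let ?r = "\<lambda>f. lin_ext (\<lambda>b. Poly_Mapping.single (face_word b) (1::'k)) f"
  have V: "vectorspace class_ring ?V" and F: "vectorspace class_ring ?F"
    by (rule vectorspace_free_vs)+
  have T: "vectorspace class_ring ?T"
    by (rule vectorspace_tensor_powers[OF V])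
  have C: "vectorspace class_ring ?C"
    by (rule vectorspace_cong[OF F]) (simp_all only: DeltaSym_simps)
  have D: "vectorspace class_ring ?D"
    by (rule vectorspace_cong[OF T]) (simp_all only: cofree_coalgebra_simps)
  have r: "bij_betw ?r (carrier ?F) (carrier (free_vs (lists vertices)))"
    by (rule bij_betw_free_vs[OF face_word_bij])
  have bij: "bij_betw ?\<phi> (carrier ?F) (carrier ?T)"
    using bij_betw_trans[OF r word_tensor_bij] by (simp only: face_tensor_def[abs_def] comp_def)
  have hom: "?\<phi> \<in> lin_hom ?F ?T"
    using word_tensor_hom[of vertices, where 'k='k] bij_betwE[OF r] bij_betwE[OF bij]
    by (simp add: LinearCombinations.module_hom_def face_tensor_def lin_ext_add lin_ext_scal)
  have hom': "?\<phi> \<in> lin_hom ?C ?D"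
    using hom by (simp only: LinearCombinations.module_hom_def DeltaSym_simps cofree_coalgebra_simps)
  have tensor_C: "tensor_class ?C ?C = tensor_class ?F ?F" "tensor_product ?C ?C = tensor_product ?F ?F"
    by (rule tensor_cong; simp only: DeltaSym_simps)+
  have tensor_D: "tensor_class ?D ?D = tensor_class ?T ?T" "tensor_product ?D ?D = tensor_product ?T ?T"
    by (rule tensor_cong; simp only: cofree_coalgebra_simps)+
  let ?cut = "\<lambda>(n, S). \<Sum>p\<le>n. Poly_Mapping.single (face_elt p (S \<inter> {1..p}) :: _ \<Rightarrow>\<^sub>0 'k,
      face_elt (n - p) {j \<in> {1..n - p}. j + p \<in> S} :: _ \<Rightarrow>\<^sub>0 'k) (1::'k)"
  have comult_C: "comult ?C f = tensor_class ?C ?C (lin_ext ?cut f)" for f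
    by (simp only: DeltaSym_simps tensor_C DeltaSym_comult_def)
  let ?cut_tensors = "\<lambda>(n, S). \<Sum>p\<le>n. Poly_Mapping.single (?\<phi> (face_elt p (S \<inter> {1..p})),
      ?\<phi> (face_elt (n - p) {j \<in> {1..n - p}. j + p \<in> S})) (1::'k)"
  have face_tensor_face: "?\<phi> (face_elt n S)
      = word_tensor vertices (Poly_Mapping.single (face_word (n, S)) 1)" for n S
    by (simp add: face_tensor_def face_elt_def scal_algebra)
  have "(\<Sum>p\<le>length (face_word b). Poly_Mapping.single
        (word_tensor vertices (Poly_Mapping.single (take p (face_word b)) (1::'k)),
         word_tensor vertices (Poly_Mapping.single (drop p (face_word b)) (1::'k))) (1::'k))
      = ?cut_tensors b" for b
  proof (cases b)
    case (Pair n S)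
    then show ?thesis
      by (simp only: length_face_word prod.case face_tensor_face)
        (intro sum.cong refl, simp only: take_face_word drop_face_word atMost_iff)
  qed
  then have comult_D: "comult ?D (?\<phi> f) = tensor_class ?D ?D (lin_ext ?cut_tensors f)" for f
    by (simp only: cofree_coalgebra_simps tensor_D face_tensor_def deconcatenation_word_tensor
        lin_ext_lin_ext lin_ext_single scal_algebra)
  \<comment> \<open>Both sides now have the same representative, a sum over the cuts of each face.\<close>
  have comult_hom: "comult ?D (?\<phi> f) = tensor_map ?D ?D ?\<phi> ?\<phi> (comult ?C f)" for f
    unfolding comult_D comult_C tensor_map_tensor_class[OF C C D D hom' hom']
    by (simp add: lin_ext_lin_ext split_def lin_ext_sum scal_algebra)
  have counit: "counit ?D (?\<phi> f) = counit ?C f" if "f \<in> carrier ?C" for f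
  proof -
    have "Poly_Mapping.lookup (?r f) (face_word (0, {})) = Poly_Mapping.lookup f (0, {})"
      using that by (intro lookup_lin_ext_single[OF bij_betw_imp_inj_on[OF face_word_bij]])
        (simp_all add: DeltaSym_simps faces_def)
    then show ?thesis
      by (simp add: face_tensor_def counit_word_tensor DeltaSym_simps face_word_def)
  qed
  have face: "face_elt n S \<in> carrier ?F" if "S \<subseteq> {1..n}" for n S
    using that by (simp add: face_elt_def faces_def)
  have C_closed: "comult ?C \<in> carrier ?C \<rightarrow> carrier (tensor_product ?C ?C)"
  proof
    fix f assume "f \<in> carrier ?C"
    show "comult ?C f \<in> carrier (tensor_product ?C ?C)"
      unfolding comult_C tensor_C
    proof (intro tensor_class_carrier F keys_lin_ext)
      fix b
      show "Poly_Mapping.keys (?cut b) \<subseteq> carrier ?F \<times> carrier ?F"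
        unfolding split_def by (intro keys_sum_pairs face) auto
    qed
  qed
  have D_closed: "comult ?D \<in> carrier ?D \<rightarrow> carrier (tensor_product ?D ?D)"
  proof
    fix x assume "x \<in> carrier ?D"
    then obtain f where x: "x = ?\<phi> f"
      using bij_betw_imp_surj_on[OF bij] by (auto simp only: cofree_coalgebra_simps)
    show "comult ?D x \<in> carrier (tensor_product ?D ?D)"
      unfolding x comult_D tensor_D
    proof (intro tensor_class_carrier T keys_lin_ext)
      fix b
      show "Poly_Mapping.keys ((\<lambda>(n, S). \<Sum>p\<le>n. Poly_Mapping.single (?\<phi> (face_elt p (S \<inter> {1..p})),
          ?\<phi> (face_elt (n - p) {j \<in> {1..n - p}. j + p \<in> S})) (1::'k)) b) \<subseteq> carrier ?T \<times> carrier ?T"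
        unfolding split_def by (intro keys_sum_pairs bij_betwE[OF bij, rule_format] face) auto
    qed
  qed
  have "linear_map class_ring ?C ?D ?\<phi>"
    using C D hom'
    by (simp add: linear_map_def mod_hom_def mod_hom_axioms_def vectorspace_def)
  then have "coalgebra_iso ?C ?D ?\<phi>"
    unfolding coalgebra_iso_def
    using bij C_closed D_closed comult_hom counit by (simp add: DeltaSym_simps cofree_coalgebra_simps)
  with V show ?thesis
    unfolding cofree_def by blast
qed

end
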